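(* Let $m\ge1$ be an integer, let $(x_n)_{n\ge m}$ be a sequence of integers, and let $(z_n)_{n\ge1}$ be defined by the formal power series identity $$1+\sum_{n=1}^\infty z_nt^n=\left(1-\sum_{n=m}^\infty x_nt^n\right)^{-1}.$$ Then for every $n\ge1$: (i) $$z_n=\sum_{mt_m+(m+1)t_{m+1}+\cdots+nt_n=n}\binom{t_m+t_{m+1}+\cdots+t_n}{t_m,t_{m+1},\dots,t_n}x_m^{t_m}x_{m+1}^{t_{m+1}}\cdots x_n^{t_n},$$ the sum being over nonnegative integers $t_m,\dots,t_n$ (an empty sum, equal to $0$, if $n<m$); (ii) $$\begin{vmatrix} z_1&1&0&&\\ z_2&z_1&&&\\ \vdots&\vdots&\ddots&1&0\\ z_{n-1}&z_{n-2}&\cdots&z_1&1\\ z_n&z_{n-1}&\cdots&z_2&z_1\end{vmatrix}=\begin{cases}(-1)^{n-1}x_n&(n\ge m)\\ 0&(1\le n\le m-1),\end{cases}$$ where the $n\times n$ matrix has $(i,j)$ entry $z_{i-j+1}$ for $i\ge j$, $1$ for $j=i+1$, and $0$ for $j>i+1$; (iii) $$\sum_{k=1}^{n}(-1)^{k-1}\sum_{\substack{i_1+\cdots+i_k=n\\ i_1,\dots,i_k\ge1}}z_{i_1}\cdots z_{i_k}=\sum_{t_1+2t_2+\cdots+nt_n=n}\binom{t_1+\cdots+t_n}{t_1,\dots,t_n}(-1)^{t_1+\cdots+t_n-1}z_1^{t_1}\cdots z_n^{t_n}=\begin{cases}x_n&(n\ge m)\\ 0&(1\le n\le m-1),\end{cases}$$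 the middle sum being over nonnegative integers $t_1,\dots,t_n$.
   Context: $\binom{t_1+\cdots+t_r}{t_1,\dots,t_r}=\frac{(t_1+\cdots+t_r)!}{t_1!\cdots t_r!}$ is the multinomial coefficient, and $0^0=1$. Sums over $i_1+\cdots+i_k=n$ run over ordered $k$-tuples of integers. *)

theory Defs
  imports
    "HOL-Computational_Algebra.Formal_Power_Series"
    "HOL-Library.FuncSet"
    "Jordan_Normal_Form.Determinant"
begin

text \<open>The division is exact, see \<open>multinomial_exact\<close> below.\<close>

definition multinomial :: "'a set \<Rightarrow> ('a \<Rightarrow> nat) \<Rightarrow> nat" where
  "multinomial J t = fact (\<Sum>j\<in>J. t j) div (\<Prod>j\<in>J. fact (t j))"

lemma prod_fact_dvd_fact_sum:
  fixes t :: "'a \<Rightarrow> nat"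
  assumes "finite J"
  shows "(\<Prod>j\<in>J. fact (t j) :: nat) dvd fact (\<Sum>j\<in>J. t j)"
  using assms
proof (induction J rule: finite_induct)
  case empty
  then show ?case by simp
next
  case (insert a J)
  have "(fact (t a) * (\<Prod>j\<in>J. fact (t j)) :: nat) dvd fact (t a) * fact (\<Sum>j\<in>J. t j)"
    using insert.IH by (rule mult_dvd_mono[OF dvd_refl])
  also have "(fact (t a) * fact (\<Sum>j\<in>J. t j) :: nat) dvd fact (t a + (\<Sum>j\<in>J. t j))"
    by (rule fact_fact_dvd_fact)
  finally show ?case using insert.hyps by simp
qed

lemma multinomial_exact:
  assumes "finite J"
  shows "multinomial J t * (\<Prod>j\<in>J. fact (t j)) = fact (\<Sum>j\<in>J. t j)"
  unfolding multinomial_def using prod_fact_dvd_fact_sum[OF assms] by (rule dvd_div_mult_self)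

text \<open>The exponent tuples \<open>(t\<^sub>a, \<dots>, t\<^sub>n)\<close> with \<open>a t\<^sub>a + \<dots> + n t\<^sub>n = n\<close>, as extensional
  functions on \<open>{a..n}\<close>, so that each tuple is represented exactly once. For \<open>n < a\<close> and
  \<open>n \<ge> 1\<close> there are none.\<close>

definition weighted_tuples :: "nat \<Rightarrow> nat \<Rightarrow> (nat \<Rightarrow> nat) set" where
  "weighted_tuples a n = {t \<in> {a..n} \<rightarrow>\<^sub>E UNIV. (\<Sum>j\<in>{a..n}. j * t j) = n}"

lemma finite_weighted_tuples:
  assumes "a \<ge> 1"
  shows "finite (weighted_tuples a n)"
proof (rule finite_subset)
  show "weighted_tuples a n \<subseteq> {a..n} \<rightarrow>\<^sub>E {..n}"
  proof
    fix t assume "t \<in> weighted_tuples a n"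
    then have t: "t \<in> {a..n} \<rightarrow>\<^sub>E UNIV" and s: "(\<Sum>j\<in>{a..n}. j * t j) = n"
      by (auto simp: weighted_tuples_def)
    have "t j \<le> n" if j: "j \<in> {a..n}" for j
    proof -
      have "t j \<le> j * t j" using j assms by simp
      also have "j * t j \<le> (\<Sum>j\<in>{a..n}. j * t j)" using j by (intro member_le_sum) auto
      finally show ?thesis using s by simp
    qed
    with t show "t \<in> {a..n} \<rightarrow>\<^sub>E {..n}" by (auto simp: PiE_iff)
  qed
  show "finite ({a..n} \<rightarrow>\<^sub>E {..n} :: (nat \<Rightarrow> nat) set)" by (rule finite_PiE) auto
qed

definition compositions :: "nat \<Rightarrow> nat \<Rightarrow> nat list set" where
  "compositions k n = {is. length is = k \<and> (\<forall>i\<in>set is. i \<ge> 1) \<and> sum_list is = n}"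

lemma finite_compositions: "finite (compositions k n)"
proof (rule finite_subset)
  show "compositions k n \<subseteq> {is. set is \<subseteq> {..n} \<and> length is = k}"
    by (auto simp: compositions_def dest: member_le_sum_list)
  show "finite {is. set is \<subseteq> {..n} \<and> length is = k}"
    by (rule finite_lists_length_eq) simp
qed

text \<open>Rows and columns are numbered from \<open>0\<close>; the entries depend on \<open>i - j\<close> only, so
  the formulas are the same as with numbering from \<open>1\<close>.\<close>

definition toeplitz_hessenberg :: "nat \<Rightarrow> (nat \<Rightarrow> int) \<Rightarrow> int mat" where
  "toeplitz_hessenberg n z =
     mat n n (\<lambda>(i, j). if j \<le> i then z (i - j + 1) else if j = i + 1 then 1 else 0)"

text \<open>Type \<^typ>\<open>int\<close> has no \<^const>\<open>inverse\<close>, so inverses of integer power series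
  with constant term \<open>1\<close> are written \<open>fps_left_inverse f 1\<close>, where \<open>1\<close> is the inverse of the
  constant term. This is the inverse in the ring of integer power series:\<close>

lemma eq_fps_left_inverse_iff:
  fixes f g :: "int fps"
  assumes "fps_nth f 0 = 1"
  shows "g = fps_left_inverse f 1 \<longleftrightarrow> g * f = 1"
proof -
  have inv: "fps_left_inverse f 1 * f = 1" using assms by (intro fps_left_inverse) simp
  have "f \<noteq> 0" using assms by auto
  then show ?thesis using inv by (metis mult_right_cancel)
qed

end

theory Submission
  imports Defs
begin

text \<open>
  Write \<open>Z = \<Sum>\<^sub>i z\<^sub>i t\<^sup>i\<close> and \<open>X = \<Sum>\<^sub>i x\<^sub>i t\<^sup>i\<close> for the two series without constant term, where
  \<open>x\<^sub>i\<close> is read as \<open>0\<close> for \<open>i < m\<close>, so that \<open>(1 + Z) (1 - X) = 1\<close>. Parts (i) and (iii) are two readings of the geometric series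
  \<open>(1 - F)\<inverse> = \<Sum>\<^sub>k F\<^sup>k\<close>, whose coefficient at \<open>t\<^sup>n\<close> only involves the powers with \<open>k \<le> n\<close>
  (\<open>geometric_series_nth\<close>). The coefficient of \<open>F\<^sup>k\<close> at \<open>t\<^sup>n\<close> can be written as a sum over the
  compositions of \<open>n\<close> into \<open>k\<close> parts (\<open>fps_power_nth_compositions\<close>), or, collecting equal factors
  by the multinomial theorem, as a sum over exponent tuples (\<open>fps_power_nth_multinomial\<close>). For
  \<open>F = X\<close> the second form gives (i). The defining identity is symmetric: it also says that
  \<open>1 - X\<close> is the inverse of \<open>1 - (- Z)\<close>, and \<open>F = - Z\<close> gives both sums in (iii), the sign
  \<open>(-1)\<^sup>k\<^sup>-\<^sup>1\<close> being that of \<open>(- Z)\<^sup>k\<close> moved across \<open>- X\<close>.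

  For (ii), a power series acts on the first coefficients of another one by a lower triangular
  Toeplitz matrix, and this representation is multiplicative. The matrix of \<open>1 + Z\<close> of size
  \<open>n + 1\<close> has determinant \<open>1\<close>, so its adjugate is its inverse, the matrix of \<open>1 - X\<close>. The
  Hessenberg matrix is what remains of the matrix of \<open>1 + Z\<close> without its first row and last
  column, hence its determinant is, up to the sign \<open>(-1)\<^sup>n\<close>, the bottom left entry \<open>- x\<^sub>n\<close> of
  that inverse (\<open>det_toeplitz_hessenberg\<close>).
\<close>

no_notation vec_index (infixl "$" 100)
unbundle fps_syntax

section \<open>The multinomial theorem\<close>

definition exponent_tuples :: "'a set \<Rightarrow> nat \<Rightarrow> ('a \<Rightarrow> nat) set" where
  "exponent_tuples J k = {t \<in> J \<rightarrow>\<^sub>E UNIV. (\<Sum>j\<in>J. t j) = k}"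

lemma finite_exponent_tuples:
  assumes "finite J"
  shows "finite (exponent_tuples J k)"
proof (rule finite_subset)
  show "exponent_tuples J k \<subseteq> J \<rightarrow>\<^sub>E {..k}"
    using assms by (auto simp: exponent_tuples_def PiE_iff intro: member_le_sum dest: extensional_arb)
  show "finite (J \<rightarrow>\<^sub>E {..k})"
    using assms by (intro finite_PiE) auto
qed

lemma multinomial_cong:
  assumes "\<And>j. j \<in> J \<Longrightarrow> s j = t j"
  shows "multinomial J s = multinomial J t"
  using assms by (simp add: multinomial_def)

text \<open>Distributing a set into labelled blocks amounts to choosing the block \<open>a\<close> first and
  distributing the rest. This recursion drives the induction in the multinomial theorem.\<close>

lemma multinomial_insert:
  assumes "finite J" "a \<notin> J"
  shows "multinomial (insert a J) t = ((t a + (\<Sum>j\<in>J. t j)) choose t a) * multinomial J t"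
proof -
  let ?s = "\<Sum>j\<in>J. t j" and ?p = "\<Prod>j\<in>J. fact (t j) :: nat"
  have "multinomial (insert a J) t * (fact (t a) * ?p) = fact (t a + ?s)"
    using multinomial_exact[of "insert a J" t] assms by simp
  also have "\<dots> = ((t a + ?s) choose t a) * fact (t a) * fact ?s"
    using binomial_fact_lemma[of "t a" "t a + ?s"] by (simp add: mult_ac)
  also have "\<dots> = ((t a + ?s) choose t a) * fact (t a) * (multinomial J t * ?p)"
    by (simp only: multinomial_exact[OF assms(1)])
  finally have "multinomial (insert a J) t * (fact (t a) * ?p)
      = (((t a + ?s) choose t a) * multinomial J t) * (fact (t a) * ?p)"
    by (simp only: mult_ac)
  moreover have "fact (t a) * ?p \<noteq> 0" using assms by simp
  ultimately show ?thesis by (metis mult_right_cancel)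
qed

text \<open>Induction on the index set: the binomial theorem splits off the summand \<open>f a\<close>, the induction
  hypothesis expands the other factor, and an exponent tuple on \<open>insert a J\<close> is the same as the
  exponent of \<open>f a\<close> together with a tuple on \<open>J\<close> for the remaining degree.\<close>

theorem multinomial_theorem:
  fixes f :: "'a \<Rightarrow> 'b :: comm_semiring_1"
  assumes "finite J"
  shows "(\<Sum>j\<in>J. f j) ^ k
    = (\<Sum>t\<in>exponent_tuples J k. of_nat (multinomial J t) * (\<Prod>j\<in>J. f j ^ t j))"
  using assms
proof (induction J arbitrary: k rule: finite_induct)
  case empty
  then show ?case by (cases k) (auto simp: exponent_tuples_def multinomial_def)
next
  case (insert a J)
  have upd: "(\<Prod>j\<in>J. f j ^ (s(a := i)) j) = (\<Prod>j\<in>J. f j ^ s j)"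
    "(\<Sum>j\<in>J. (s(a := i)) j) = (\<Sum>j\<in>J. s j)"
    "multinomial J (s(a := i)) = multinomial J s" for s i
    using insert.hyps by (auto intro!: prod.cong sum.cong multinomial_cong)
  have "(\<Sum>j\<in>insert a J. f j) ^ k
      = (\<Sum>i\<le>k. of_nat (k choose i) * f a ^ i * (\<Sum>j\<in>J. f j) ^ (k - i))"
    using insert.hyps by (simp add: binomial_ring)
  also have "\<dots> = (\<Sum>i\<le>k. \<Sum>s\<in>exponent_tuples J (k - i). of_nat (k choose i) * f a ^ i *
      (of_nat (multinomial J s) * (\<Prod>j\<in>J. f j ^ s j)))"
    by (simp add: insert.IH sum_distrib_left)
  also have "\<dots> = (\<Sum>(i, s)\<in>(SIGMA i:{..k}. exponent_tuples J (k - i)).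
      of_nat (k choose i) * f a ^ i * (of_nat (multinomial J s) * (\<Prod>j\<in>J. f j ^ s j)))"
    by (intro sum.Sigma) (auto simp: finite_exponent_tuples insert.hyps)
  also have "\<dots> = (\<Sum>t\<in>exponent_tuples (insert a J) k.
      of_nat (multinomial (insert a J) t) * (\<Prod>j\<in>insert a J. f j ^ t j))"
    \<comment> \<open>Tuples are extensional, so forgetting the exponent at \<open>a\<close> means resetting it to
      \<open>undefined\<close>.\<close>
  proof (rule sum.reindex_bij_witness[where j = "\<lambda>(i, s). s(a := i)"
        and i = "\<lambda>t. (t a, t(a := undefined))"], goal_cases)
    case (1 p)
    then show ?case using insert.hyps
      by (auto simp: exponent_tuples_def PiE_iff extensional_def fun_eq_iff)
  next
    case (2 p)
    then show ?case using insert.hyps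
      by (auto simp: exponent_tuples_def upd PiE_iff extensional_def simp del: fun_upd_apply)
        (auto split: if_splits)
  next
    case (3 t)
    then show ?case by simp
  next
    case (4 t)
    then show ?case using insert.hyps
      by (auto simp: exponent_tuples_def upd PiE_iff extensional_def simp del: fun_upd_apply)
         auto
  next
    case (5 p)
    then show ?case using insert.hyps
      by (auto simp: exponent_tuples_def upd multinomial_insert mult_ac simp del: fun_upd_apply)
         (auto simp: mult_ac)
  qed
  finally show ?case .
qed

section \<open>Coefficients of powers of a power series\<close>

lemma fps_power_nth_cong:
  fixes F G :: "'a :: comm_ring_1 fps"
  assumes "\<And>i. i \<le> n \<Longrightarrow> F $ i = G $ i" "i \<le> n"
  shows "(F ^ k) $ i = (G ^ k) $ i"
  using assms(2)
  by (induction k arbitrary: i) (auto simp: fps_mult_nth assms(1) intro!: sum.cong)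

text \<open>Expanding \<open>F\<^sup>k\<close> as a product, each of the \<open>k\<close> factors contributes one part; parts \<open>0\<close> do not
  occur because the constant term vanishes.\<close>

lemma fps_power_nth_compositions:
  fixes F :: "'a :: comm_ring_1 fps"
  assumes "F $ 0 = 0"
  shows "(F ^ k) $ n = (\<Sum>is\<in>compositions k n. \<Prod>i\<leftarrow>is. F $ i)"
proof (induction k arbitrary: n)
  case 0
  have "compositions 0 n = (if n = 0 then {[]} else {})"
    by (auto simp: compositions_def)
  then show ?case by simp
next
  case (Suc k)
  have "(F ^ Suc k) $ n = (\<Sum>i=0..n. F $ i * (\<Sum>is\<in>compositions k (n - i). \<Prod>j\<leftarrow>is. F $ j))"
    by (simp add: fps_mult_nth Suc.IH)
  also have "\<dots> = (\<Sum>i=1..n. F $ i * (\<Sum>is\<in>compositions k (n - i). \<Prod>j\<leftarrow>is. F $ j))"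
    using assms by (simp add: sum.atLeast_Suc_atMost)
  also have "\<dots> = (\<Sum>(i, is)\<in>(SIGMA i:{1..n}. compositions k (n - i)). F $ i * (\<Prod>j\<leftarrow>is. F $ j))"
    by (simp add: sum_distrib_left sum.Sigma finite_compositions)
  also have "\<dots> = (\<Sum>is\<in>compositions (Suc k) n. \<Prod>i\<leftarrow>is. F $ i)"
    by (rule sum.reindex_bij_witness[where j = "\<lambda>(i, is). i # is" and i = "\<lambda>is. (hd is, tl is)"])
      (auto simp: compositions_def length_Suc_conv)
  finally show ?case .
qed

lemma monomial_product_nth:
  fixes c :: "nat \<Rightarrow> 'a :: comm_ring_1"
  assumes "finite J"
  shows "(\<Prod>j\<in>J. (fps_const (c j) * fps_X ^ j) ^ t j) $ n
    = (if (\<Sum>j\<in>J. j * t j) = n then \<Prod>j\<in>J. c j ^ t j else 0)"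
proof -
  have "(\<Prod>j\<in>J. (fps_const (c j) * fps_X ^ j) ^ t j)
      = fps_const (\<Prod>j\<in>J. c j ^ t j) * fps_X ^ (\<Sum>j\<in>J. j * t j)"
    using assms
    by (induction J rule: finite_induct)
      (simp_all add: power_mult_distrib fps_const_power power_add mult_ac flip: power_mult fps_const_mult)
  then show ?thesis by simp
qed

text \<open>The coefficient of \<open>F\<^sup>k\<close> at \<open>t\<^sup>n\<close> depends only on the coefficients of \<open>F\<close> up to \<open>t\<^sup>n\<close>, so \<open>F\<close> may be
  replaced by a finite sum of monomials, to which the multinomial theorem applies; the condition
  \<open>\<Sum>\<^sub>j j t\<^sub>j = n\<close> selects the monomials of degree \<open>n\<close>.\<close>

lemma fps_power_nth_multinomial:
  fixes F :: "'a :: comm_ring_1 fps"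
  assumes "\<And>i. i < a \<Longrightarrow> F $ i = 0"
  shows "(F ^ k) $ n = (\<Sum>t\<in>{t \<in> weighted_tuples a n. (\<Sum>j\<in>{a..n}. t j) = k}.
    of_nat (multinomial {a..n} t) * (\<Prod>j\<in>{a..n}. (F $ j) ^ t j))"
proof -
  let ?J = "{a..n}"
  define G where "G = (\<Sum>j\<in>?J. fps_const (F $ j) * fps_X ^ j)"
  have G: "G $ i = F $ i" if "i \<le> n" for i
  proof -
    have "G $ i = (\<Sum>j\<in>?J. if j = i then F $ j else 0)"
      unfolding G_def fps_sum_nth by (intro sum.cong) auto
    also have "\<dots> = F $ i" using that assms by auto
    finally show ?thesis .
  qed
  have "(F ^ k) $ n = (G ^ k) $ n"
    by (rule fps_power_nth_cong[where n = n]) (auto simp: G)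
  also have "\<dots> = (\<Sum>t\<in>exponent_tuples ?J k. of_nat (multinomial ?J t) *
      (if (\<Sum>j\<in>?J. j * t j) = n then \<Prod>j\<in>?J. (F $ j) ^ t j else 0))"
    unfolding G_def
    by (simp add: multinomial_theorem fps_sum_nth monomial_product_nth
        fps_mult_left_const_nth flip: fps_of_nat)
  also have "\<dots> = (\<Sum>t\<in>{t \<in> weighted_tuples a n. (\<Sum>j\<in>?J. t j) = k}.
      of_nat (multinomial ?J t) * (\<Prod>j\<in>?J. (F $ j) ^ t j))"
    by (rule sum.mono_neutral_cong_right[OF finite_exponent_tuples])
      (auto simp: exponent_tuples_def weighted_tuples_def)
  finally show ?thesis .
qed

section \<open>Expanding the inverse of a power series\<close>

text \<open>The partial sum up to \<open>F\<^sup>n\<close> differs from \<open>G\<close> by \<open>G F\<^sup>n\<^sup>+\<^sup>1\<close>, which has no terms of degree at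
  most \<open>n\<close>.\<close>

lemma geometric_series_nth:
  fixes F G :: "'a :: comm_ring_1 fps"
  assumes "F $ 0 = 0" and inv: "G * (1 - F) = 1"
  shows "G $ n = (\<Sum>k\<le>n. (F ^ k) $ n)"
proof -
  have "(\<Sum>k\<le>n. F ^ k) = G * (1 - F) * (\<Sum>k\<le>n. F ^ k)"
    by (simp add: inv)
  also have "\<dots> = G - G * F ^ Suc n"
    by (simp only: mult.assoc sum_gp_basic) (simp add: algebra_simps)
  finally have "(\<Sum>k\<le>n. F ^ k) = G - G * F ^ Suc n" .
  moreover have "(G * F ^ Suc n) $ n = 0"
    using startsby_zero_power_prefix[OF assms(1), of "Suc n"]
    by (simp add: fps_mult_nth del: power_Suc)
  ultimately have "(\<Sum>k\<le>n. F ^ k) $ n = G $ n" by (simp del: power_Suc)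
  then show ?thesis by (simp add: fps_sum_nth)
qed

text \<open>Since all indices are at least \<open>a \<ge> 1\<close>, a tuple of weight \<open>n\<close> has degree at most \<open>n\<close>, so
  the tuples of degrees \<open>0, \<dots>, n\<close> that arise from the powers \<open>F\<^sup>0, \<dots>, F\<^sup>n\<close> are all the tuples of
  weight \<open>n\<close>.\<close>

lemma inverse_nth_multinomial:
  fixes F G :: "'a :: comm_ring_1 fps"
  assumes a: "a \<ge> 1" and F: "\<And>i. i < a \<Longrightarrow> F $ i = 0" and inv: "G * (1 - F) = 1"
  shows "G $ n = (\<Sum>t\<in>weighted_tuples a n.
    of_nat (multinomial {a..n} t) * (\<Prod>j\<in>{a..n}. (F $ j) ^ t j))"
proof -
  have "(\<Sum>j\<in>{a..n}. t j) \<le> n" if "t \<in> weighted_tuples a n" for t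
  proof -
    have "(\<Sum>j\<in>{a..n}. t j) \<le> (\<Sum>j\<in>{a..n}. j * t j)"
      using a by (intro sum_mono) auto
    then show ?thesis using that by (simp add: weighted_tuples_def)
  qed
  then have "(\<Sum>k\<le>n. \<Sum>t\<in>{t \<in> weighted_tuples a n. (\<Sum>j\<in>{a..n}. t j) = k}.
      of_nat (multinomial {a..n} t) * (\<Prod>j\<in>{a..n}. (F $ j) ^ t j))
    = (\<Sum>t\<in>weighted_tuples a n. of_nat (multinomial {a..n} t) * (\<Prod>j\<in>{a..n}. (F $ j) ^ t j))"
    using a by (intro sum.group) (auto simp: finite_weighted_tuples)
  moreover have "G $ n = (\<Sum>k\<le>n. (F ^ k) $ n)"
    using a F inv by (intro geometric_series_nth) auto
  ultimately show ?thesis by (simp add: fps_power_nth_multinomial[of a F, OF F])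
qed

section \<open>The determinant\<close>

text \<open>The matrix of multiplication by \<open>F\<close> on power series modulo \<open>t\<^sup>N\<close> in the basis
  \<open>1, t, \<dots>, t\<^sup>N\<^sup>-\<^sup>1\<close>.\<close>

definition toeplitz_mat :: "nat \<Rightarrow> 'a :: comm_ring_1 fps \<Rightarrow> 'a mat" where
  "toeplitz_mat N F = mat N N (\<lambda>(i, j). if j \<le> i then F $ (i - j) else 0)"

lemma toeplitz_mat_carrier [simp]: "toeplitz_mat N F \<in> carrier_mat N N"
  by (simp add: toeplitz_mat_def)

lemma toeplitz_mat_one: "toeplitz_mat N 1 = 1\<^sub>m N"
  by (rule eq_matI) (auto simp: toeplitz_mat_def)

lemma toeplitz_mat_mult: "toeplitz_mat N (F * G) = toeplitz_mat N F * toeplitz_mat N G"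
proof (rule eq_matI)
  fix i j assume "i < dim_row (toeplitz_mat N F * toeplitz_mat N G)"
    "j < dim_col (toeplitz_mat N F * toeplitz_mat N G)"
  then have ij: "i < N" "j < N" by (auto simp: toeplitz_mat_def)
  have "(toeplitz_mat N F * toeplitz_mat N G) $$ (i, j)
      = (\<Sum>k = 0..<N. (if k \<le> i then F $ (i - k) else 0) * (if j \<le> k then G $ (k - j) else 0))"
    using ij by (simp add: toeplitz_mat_def scalar_prod_def)
  also have "\<dots> = (\<Sum>k\<in>{j..i}. F $ (i - k) * G $ (k - j))"
    using ij by (intro sum.mono_neutral_cong_right) auto
  also have "\<dots> = (if j \<le> i then \<Sum>l = 0..i - j. F $ l * G $ (i - j - l) else 0)"
    by (auto intro!: sum.reindex_bij_witness[where i = "\<lambda>l. i - l" and j = "\<lambda>k. i - k"])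
  also have "\<dots> = toeplitz_mat N (F * G) $$ (i, j)"
    using ij by (simp add: toeplitz_mat_def fps_mult_nth)
  finally show "toeplitz_mat N (F * G) $$ (i, j) = (toeplitz_mat N F * toeplitz_mat N G) $$ (i, j)"
    by simp
qed (auto simp: toeplitz_mat_def)

lemma det_toeplitz_mat:
  assumes "F $ 0 = 1"
  shows "det (toeplitz_mat N F) = 1"
proof -
  have "det (toeplitz_mat N F) = prod_list (diag_mat (toeplitz_mat N F))"
    by (rule det_lower_triangular[of N]) (auto simp: toeplitz_mat_def)
  also have "diag_mat (toeplitz_mat N F) = replicate N 1"
    using assms by (auto simp: diag_mat_def toeplitz_mat_def intro!: nth_equalityI)
  finally show ?thesis by simp
qed

text \<open>The adjugate of a matrix of determinant \<open>1\<close> is its inverse. This turns minors of the matrix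
  of \<open>F\<close> into coefficients of the inverse series.\<close>

lemma adj_mat_toeplitz_mat:
  assumes "F $ 0 = 1" "F * G = 1"
  shows "adj_mat (toeplitz_mat N F) = toeplitz_mat N G"
proof -
  let ?F = "toeplitz_mat N F" and ?G = "toeplitz_mat N G"
  note adj = adj_mat[of ?F N, OF toeplitz_mat_carrier]
  have "adj_mat ?F = adj_mat ?F * (?F * ?G)"
    using adj(1) assms(2) by (simp flip: toeplitz_mat_mult add: toeplitz_mat_one)
  also have "\<dots> = adj_mat ?F * ?F * ?G"
    using adj(1) by (simp add: assoc_mult_mat[of _ N N _ N _ N])
  also have "adj_mat ?F * ?F = 1\<^sub>m N"
    unfolding adj(3) det_toeplitz_mat[OF assms(1)] by (rule eq_matI) auto
  also have "1\<^sub>m N * ?G = ?G"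
    by (simp add: left_mult_one_mat[of _ N N])
  finally show ?thesis .
qed

text \<open>Deleting the first row and the last column of the matrix of \<open>F\<close> moves its diagonal of ones to
  the superdiagonal, which leaves the Hessenberg matrix. Its determinant is therefore the minor
  that determines the bottom left entry of the adjugate.\<close>

lemma det_toeplitz_hessenberg:
  assumes F: "F $ 0 = 1" "F * G = 1" and z: "\<And>i. i \<ge> 1 \<Longrightarrow> F $ i = z i"
  shows "det (toeplitz_hessenberg n z) = (-1) ^ n * G $ n"
proof -
  let ?T = "toeplitz_mat (Suc n) F"
  have "mat_delete ?T 0 n = toeplitz_hessenberg n z"
    by (rule eq_matI)
      (auto simp: mat_delete_def toeplitz_mat_def toeplitz_hessenberg_def F z Suc_diff_le not_le
        dest!: le_antisym)
  then have "(-1) ^ n * det (toeplitz_hessenberg n z) = cofactor ?T 0 n"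
    by (simp add: cofactor_def)
  also have "\<dots> = adj_mat ?T $$ (n, 0)"
    by (simp add: adj_mat_def toeplitz_mat_def)
  also have "\<dots> = G $ n"
    by (simp add: adj_mat_toeplitz_mat[OF F]) (simp add: toeplitz_mat_def)
  finally have "(-1) ^ n * ((-1) ^ n * det (toeplitz_hessenberg n z)) = (-1) ^ n * G $ n"
    by simp
  then show ?thesis by (simp flip: mult.assoc power_mult_distrib)
qed

section \<open>The sequences \<open>x\<close> and \<open>z\<close>\<close>

theorem lemma8:
  fixes m n :: nat and x z :: "nat \<Rightarrow> int"
  assumes m: "m \<ge> 1"
    and z: "1 + Abs_fps (\<lambda>n. if n \<ge> 1 then z n else 0)
              = fps_left_inverse (1 - Abs_fps (\<lambda>n. if n \<ge> m then x n else 0)) 1"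
    and n: "n \<ge> 1"
  shows
    "z n = (\<Sum>t\<in>weighted_tuples m n.
              int (multinomial {m..n} t) * (\<Prod>j\<in>{m..n}. x j ^ t j))
     \<and> det (toeplitz_hessenberg n z) = (if n \<ge> m then (-1) ^ (n - 1) * x n else 0)
     \<and> (\<Sum>k=1..n. (-1) ^ (k - 1) * (\<Sum>is\<in>compositions k n. \<Prod>i\<leftarrow>is. z i))
         = (\<Sum>t\<in>weighted_tuples 1 n.
              int (multinomial {1..n} t) * (-1) ^ ((\<Sum>j\<in>{1..n}. t j) - 1)
                * (\<Prod>j\<in>{1..n}. z j ^ t j))
     \<and> (\<Sum>t\<in>weighted_tuples 1 n.
              int (multinomial {1..n} t) * (-1) ^ ((\<Sum>j\<in>{1..n}. t j) - 1)
                * (\<Prod>j\<in>{1..n}. z j ^ t j))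
         = (if n \<ge> m then x n else 0)"
proof -
  define Z where "Z = Abs_fps (\<lambda>n. if n \<ge> 1 then z n else 0)"
  define X where "X = Abs_fps (\<lambda>n. if n \<ge> m then x n else 0)"
  have Z0: "Z $ 0 = 0" and Z_nth: "\<And>i. i \<ge> 1 \<Longrightarrow> Z $ i = z i" by (auto simp: Z_def)
  have X0: "\<And>i. i < m \<Longrightarrow> X $ i = 0" and X_nth: "X $ n = (if n \<ge> m then x n else 0)"
    by (auto simp: X_def)
  have inv: "(1 + Z) * (1 - X) = 1"
    using z m eq_fps_left_inverse_iff[of "1 - X" "1 + Z"] by (simp add: Z_def X_def)
  have inv': "(1 - X) * (1 - (- Z)) = 1"
    using inv by (simp add: mult.commute)

  have i: "z n = (\<Sum>t\<in>weighted_tuples m n.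
      int (multinomial {m..n} t) * (\<Prod>j\<in>{m..n}. x j ^ t j))"
  proof -
    have "z n = (1 + Z) $ n" using n by (simp add: Z_nth)
    also have "\<dots> = (\<Sum>t\<in>weighted_tuples m n.
        of_nat (multinomial {m..n} t) * (\<Prod>j\<in>{m..n}. (X $ j) ^ t j))"
      by (rule inverse_nth_multinomial[OF m X0 inv])
    finally show ?thesis by (simp add: X_def)
  qed

  have ii: "det (toeplitz_hessenberg n z) = (if n \<ge> m then (-1) ^ (n - 1) * x n else 0)"
  proof -
    have "det (toeplitz_hessenberg n z) = (-1) ^ n * (1 - X) $ n"
      using inv by (intro det_toeplitz_hessenberg[of "1 + Z"]) (auto simp: Z_def)
    then show ?thesis using n X_nth by (cases n) auto
  qed

  have comp: "(\<Sum>k=1..n. (-1) ^ (k - 1) * (\<Sum>is\<in>compositions k n. \<Prod>i\<leftarrow>is. z i)) = X $ n"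
  proof -
    have "- X $ n = (1 - X) $ n" using n by simp
    also have "\<dots> = (\<Sum>k\<le>n. ((- Z) ^ k) $ n)"
      by (rule geometric_series_nth[OF _ inv']) (simp add: Z0)
    also have "\<dots> = (\<Sum>k\<le>n. (-1) ^ k * (\<Sum>is\<in>compositions k n. \<Prod>i\<leftarrow>is. Z $ i))"
    proof (intro sum.cong refl)
      fix k
      have "(- Z) ^ k = fps_const ((-1) ^ k) * Z ^ k"
        by (subst power_minus) (simp flip: fps_const_power fps_const_neg)
      then show "((- Z) ^ k) $ n = (-1) ^ k * (\<Sum>is\<in>compositions k n. \<Prod>i\<leftarrow>is. Z $ i)"
        by (simp add: fps_power_nth_compositions[OF Z0])
    qed
    also have "\<dots> = (\<Sum>k=1..n. (-1) ^ k * (\<Sum>is\<in>compositions k n. \<Prod>i\<leftarrow>is. Z $ i))"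
      using n by (intro sum.mono_neutral_right) (auto simp: compositions_def not_less_eq_eq)
    also have "\<dots> = - (\<Sum>k=1..n. (-1) ^ (k - 1) * (\<Sum>is\<in>compositions k n. \<Prod>i\<leftarrow>is. z i))"
      unfolding sum_negf[symmetric]
    proof (intro sum.cong refl)
      fix k assume "k \<in> {1..n}"
      moreover have "(\<Prod>i\<leftarrow>is. Z $ i) = (\<Prod>i\<leftarrow>is. z i)" if "is \<in> compositions k n" for "is"
        using that by (intro arg_cong[where f = prod_list] map_cong) (auto simp: compositions_def Z_nth)
      ultimately show "(-1) ^ k * (\<Sum>is\<in>compositions k n. \<Prod>i\<leftarrow>is. Z $ i)
          = - ((-1) ^ (k - 1) * (\<Sum>is\<in>compositions k n. \<Prod>i\<leftarrow>is. z i))"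
        by (cases k) auto
    qed
    finally show ?thesis by simp
  qed

  have tup: "(\<Sum>t\<in>weighted_tuples 1 n. int (multinomial {1..n} t) *
      (-1) ^ ((\<Sum>j\<in>{1..n}. t j) - 1) * (\<Prod>j\<in>{1..n}. z j ^ t j)) = X $ n"
  proof -
    have "- X $ n = (1 - X) $ n" using n by simp
    also have "\<dots> = (\<Sum>t\<in>weighted_tuples 1 n.
        of_nat (multinomial {1..n} t) * (\<Prod>j\<in>{1..n}. ((- Z) $ j) ^ t j))"
      by (rule inverse_nth_multinomial[OF _ _ inv']) (auto simp: Z0)
    also have "\<dots> = - (\<Sum>t\<in>weighted_tuples 1 n. int (multinomial {1..n} t) *
        (-1) ^ ((\<Sum>j\<in>{1..n}. t j) - 1) * (\<Prod>j\<in>{1..n}. z j ^ t j))"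
      unfolding sum_negf[symmetric]
    proof (intro sum.cong refl)
      fix t assume t: "t \<in> weighted_tuples 1 n"
      let ?s = "\<Sum>j\<in>{1..n}. t j"
      \<comment> \<open>As \<open>n \<ge> 1\<close> the tuple is not zero, so the exponent \<open>?s - 1\<close> is not truncated.\<close>
      have "?s \<noteq> 0"
      proof
        assume "?s = 0"
        then have "(\<Sum>j\<in>{1..n}. j * t j) = 0" by simp
        then show False using t n by (simp add: weighted_tuples_def)
      qed
      then have sign: "(-1 :: int) ^ ?s = - ((-1) ^ (?s - 1))" by (cases ?s) auto
      have "(\<Prod>j\<in>{1..n}. ((- Z) $ j) ^ t j) = (\<Prod>j\<in>{1..n}. (-1) ^ t j * z j ^ t j)"
        by (intro prod.cong) (auto simp: Z_nth simp flip: power_mult_distrib)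
      also have "\<dots> = (-1) ^ ?s * (\<Prod>j\<in>{1..n}. z j ^ t j)"
        by (simp only: prod.distrib power_sum)
      also have "\<dots> = - ((-1) ^ (?s - 1) * (\<Prod>j\<in>{1..n}. z j ^ t j))"
        by (simp only: sign mult_minus_left)
      finally show "of_nat (multinomial {1..n} t) * (\<Prod>j\<in>{1..n}. ((- Z) $ j) ^ t j)
          = - (int (multinomial {1..n} t) * (-1) ^ (?s - 1) * (\<Prod>j\<in>{1..n}. z j ^ t j))"
        by (simp only: mult_minus_right mult.assoc)
    qed
    finally show ?thesis by simp
  qed

  show ?thesis using i ii comp tup X_nth by metis
qed

end
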